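(* Let $\mathcal{M}'''_m$ be a meridian surface of parabolic type from the general class, with generating functions $f(u), g(u), \varphi(v)$. Then $\mathcal{M}'''_m$ is a Chen surface if and only if $\kappa(v)$ is a constant $b\neq0$ and the meridian $m$ is determined by $f'=y(f)$, where $$y(t)=\frac{1}{2c\,t^{\pm1}}\left(c^2t^{\pm2}+b^2\right),\qquad c=\text{const}\neq0,$$ and $g(u)$ is defined by $g'(u)=-\dfrac{1}{2f'(u)}$.
   Context: $\mathbb{R}^4_1$ is the four-dimensional Minkowski space with metric $\langle\cdot,\cdot\rangle$ of signature $(3,1)$ and standard orthonormal frame $\{e_1,e_2,e_3,e_4\}$, $\langle e_1,e_1\rangle=\langle e_2,e_2\rangle=\langle e_3,e_3\rangle=1$, $\langle e_4,e_4\rangle=-1$. Put $\xi_1=\frac{e_3+e_4}{\sqrt2}$, $\xi_2=\frac{-e_3+e_4}{\sqrt2}$, so $\langle\xi_1,\xi_1\rangle=\langle\xi_2,\xi_2\rangle=0$, $\langle\xi_1,\xi_2\rangle=-1$. A meridian surface of parabolic type $\mathcal{M}'''_m$ is the spacelike surface $$z(u,v) = f(u)\,\varphi(v)\cos v\, e_1 + f(u)\,\varphi(v)\sin v\, e_2+ \left(f(u)\frac{\varphi(v)^2}{2}+g(u)\right)\xi_1 + f(u)\,\xi_2,\quad u\in I,\ v\in J,$$ where $I,J\subset\mathbb{R}$ are intervals, $f,g:I\to\mathbb{R}$ and $\varphi:J\to\mathbb{R}$ are smooth, $f>0$, $-f'g'>0$ on $I$, and $\dot\varphi^2+\varphi^2>0$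 on $J$ ($'=d/du$, dot $=d/dv$). The $u$-lines are congruent curves, called the meridians $m$, determined by $f,g$; they are assumed parameterized by arc length, i.e. $-2f'g'=1$. Their curvature is $\kappa_m(u)=\frac{f''(u)}{f'(u)}$. Put $$\kappa(v)=\frac{\varphi\ddot\varphi-2\dot\varphi^2-\varphi^2}{(\dot\varphi^2+\varphi^2)^{3/2}}.$$ The surface is from the general class if $\kappa_m(u)\,\kappa(v)\neq0$ for all $u\in I$, $v\in J$. The mean curvature vector field is $H=\frac12\operatorname{tr}\sigma$, where $\sigma$ is the second fundamental tensor. It is a standing assumption that $\langle H,H\rangle\neq0$ everywhere; put $\varepsilon=\operatorname{sign}\langle H,H\rangle$. Geometric frame: let $X=z_u$, $Y=\frac{z_v}{f\sqrt{\dot\varphi^2+\varphi^2}}$; the principal tangents are $x=\frac{X+Y}{\sqrt2}$, $y=\frac{-X+Y}{\sqrt2}$. Let $b$ be a unit normal field collinear with $H$ ($\langle b,b\rangle=\varepsilon$; its sign does not matter here, and this vector field is unrelated to the constant $b$ in the claim). With $\nabla'$ the Levi-Civita connection of $\mathbb{R}^4_1$, put $\lambda=\langle\nabla'_xy,b\rangle$. The surface is a (non-trivial) Chen surface if and only if $\lambda=0$ identically; this characterization is taken as the definition. The condition "the meridian is determined by $f'=y(f)$" means $f'(u)=y(f(u))$ for all $u\in I$ (the function $y(t)$ is unrelated to the tangent field $y$). In the formula for $y(t)$ the same sign is taken in both exponents. *)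

theory Defs
  imports "HOL-Analysis.Analysis"
begin

section \<open>Minkowski space\<close>

definition mink :: "real^4 \<Rightarrow> real^4 \<Rightarrow> real" where
  "mink x y = x$1 * y$1 + x$2 * y$2 + x$3 * y$3 - x$4 * y$4"

abbreviation e1 :: "real^4" where "e1 \<equiv> axis 1 1"
abbreviation e2 :: "real^4" where "e2 \<equiv> axis 2 1"
abbreviation e3 :: "real^4" where "e3 \<equiv> axis 3 1"
abbreviation e4 :: "real^4" where "e4 \<equiv> axis 4 1"

definition xi1 :: "real^4" where "xi1 = (1 / sqrt 2) *\<^sub>R (e3 + e4)"
definition xi2 :: "real^4" where "xi2 = (1 / sqrt 2) *\<^sub>R (- e3 + e4)"

section \<open>Calculus on intervals\<close>

text \<open>Intervals may be open, half-open or closed; at an endpoint belonging to the interval,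
  derivatives are one-sided. Degenerate intervals are excluded.\<close>

definition nondegenerate_interval :: "real set \<Rightarrow> bool" where
  "nondegenerate_interval S \<longleftrightarrow> is_interval S \<and> interior S \<noteq> {}"

definition D :: "real set \<Rightarrow> (real \<Rightarrow> 'a::real_normed_vector) \<Rightarrow> real \<Rightarrow> 'a" where
  "D S h t = vector_derivative h (at t within S)"

definition smooth_on :: "real set \<Rightarrow> (real \<Rightarrow> 'a::real_normed_vector) \<Rightarrow> bool" where
  "smooth_on S h \<longleftrightarrow> (\<forall>n. (D S ^^ n) h differentiable_on S)"

section \<open>Spacelike surfaces parameterized over a product of intervals\<close>

text \<open>A surface, and likewise a vector field along it, is a function of the two parameters
  \<open>u \<in> I\<close> and \<open>v \<in> J\<close>.\<close>

type_synonym field = "real \<Rightarrow> real \<Rightarrow> real^4"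

definition Du :: "real set \<Rightarrow> field \<Rightarrow> field" where
  "Du I W u v = D I (\<lambda>s. W s v) u"

definition Dv :: "real set \<Rightarrow> field \<Rightarrow> field" where
  "Dv J W u v = D J (\<lambda>t. W u t) v"

text \<open>The flat connection of the ambient space: for a tangent field \<open>T = \<alpha> z\<^sub>u + \<beta> z\<^sub>v\<close>
  the derivative of a field \<open>W\<close> along the surface \<open>z\<close> in direction \<open>T\<close>
  is \<open>\<alpha> W\<^sub>u + \<beta> W\<^sub>v\<close>.\<close>

definition coords :: "real set \<Rightarrow> real set \<Rightarrow> field \<Rightarrow> field \<Rightarrow> real \<Rightarrow> real \<Rightarrow> real \<times> real" where
  "coords I J z T u v = (THE p. T u v = fst p *\<^sub>R Du I z u v + snd p *\<^sub>R Dv J z u v)"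

definition nabla :: "real set \<Rightarrow> real set \<Rightarrow> field \<Rightarrow> field \<Rightarrow> field \<Rightarrow> field" where
  "nabla I J z T W u v =
     fst (coords I J z T u v) *\<^sub>R Du I W u v + snd (coords I J z T u v) *\<^sub>R Dv J W u v"

definition normal_part ::
  "real set \<Rightarrow> real set \<Rightarrow> field \<Rightarrow> real \<Rightarrow> real \<Rightarrow> real^4 \<Rightarrow> real^4" where
  "normal_part I J z u v w =
     (THE n. mink n (Du I z u v) = 0 \<and> mink n (Dv J z u v) = 0 \<and>
             w - n \<in> span {Du I z u v, Dv J z u v})"

definition second_fundamental :: "real set \<Rightarrow> real set \<Rightarrow> field \<Rightarrow> field \<Rightarrow> field \<Rightarrow> field" where
  "second_fundamental I J z T W u v = normal_part I J z u v (nabla I J z T W u v)"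

text \<open>Half the trace of the second fundamental tensor with respect to the induced metric,
  whose coefficients in the basis \<open>z\<^sub>u, z\<^sub>v\<close> are \<open>E\<close>, \<open>F\<close>, \<open>G\<close>.\<close>

definition mean_curvature :: "real set \<Rightarrow> real set \<Rightarrow> field \<Rightarrow> field" where
  "mean_curvature I J z u v =
    (let zu = Du I z; zv = Dv J z; \<sigma> = second_fundamental I J z;
         E = mink (zu u v) (zu u v); F = mink (zu u v) (zv u v); G = mink (zv u v) (zv u v)
     in (1 / 2) *\<^sub>R ((1 / (E * G - F\<^sup>2)) *\<^sub>R
          (G *\<^sub>R \<sigma> zu zu u v - (2 * F) *\<^sub>R \<sigma> zu zv u v + E *\<^sub>R \<sigma> zv zv u v)))"

text \<open>The unit normal field collinear with \<open>H\<close>, meaningful where \<open>\<langle>H,H\<rangle> \<noteq> 0\<close>;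
  its square is then the sign of \<open>\<langle>H,H\<rangle>\<close>.\<close>

definition unit_mean_curvature :: "real set \<Rightarrow> real set \<Rightarrow> field \<Rightarrow> field" where
  "unit_mean_curvature I J z u v =
    (let H = mean_curvature I J z u v in (1 / sqrt \<bar>mink H H\<bar>) *\<^sub>R H)"

section \<open>Meridian surfaces of parabolic type\<close>

definition meridian_surface ::
  "(real \<Rightarrow> real) \<Rightarrow> (real \<Rightarrow> real) \<Rightarrow> (real \<Rightarrow> real) \<Rightarrow> field" where
  "meridian_surface f g \<phi> u v =
     (f u * \<phi> v * cos v) *\<^sub>R e1 + (f u * \<phi> v * sin v) *\<^sub>R e2 +
     (f u * ((\<phi> v)\<^sup>2 / 2) + g u) *\<^sub>R xi1 + f u *\<^sub>R xi2"

definition parabolic_generators ::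
  "real set \<Rightarrow> real set \<Rightarrow> (real \<Rightarrow> real) \<Rightarrow> (real \<Rightarrow> real) \<Rightarrow> (real \<Rightarrow> real) \<Rightarrow> bool" where
  "parabolic_generators I J f g \<phi> \<longleftrightarrow>
     nondegenerate_interval I \<and> nondegenerate_interval J \<and>
     smooth_on I f \<and> smooth_on I g \<and> smooth_on J \<phi> \<and>
     (\<forall>u\<in>I. f u > 0 \<and> - D I f u * D I g u > 0) \<and>
     (\<forall>v\<in>J. (D J \<phi> v)\<^sup>2 + (\<phi> v)\<^sup>2 > 0)"

definition arc_length_meridians :: "real set \<Rightarrow> (real \<Rightarrow> real) \<Rightarrow> (real \<Rightarrow> real) \<Rightarrow> bool" where
  "arc_length_meridians I f g \<longleftrightarrow> (\<forall>u\<in>I. - 2 * D I f u * D I g u = 1)"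

definition kappa_m :: "real set \<Rightarrow> (real \<Rightarrow> real) \<Rightarrow> real \<Rightarrow> real" where
  "kappa_m I f u = D I (D I f) u / D I f u"

definition kappa :: "real set \<Rightarrow> (real \<Rightarrow> real) \<Rightarrow> real \<Rightarrow> real" where
  "kappa J \<phi> v =
     (\<phi> v * D J (D J \<phi>) v - 2 * (D J \<phi> v)\<^sup>2 - (\<phi> v)\<^sup>2)
       / ((D J \<phi> v)\<^sup>2 + (\<phi> v)\<^sup>2) powr (3 / 2)"

definition general_class ::
  "real set \<Rightarrow> real set \<Rightarrow> (real \<Rightarrow> real) \<Rightarrow> (real \<Rightarrow> real) \<Rightarrow> bool" where
  "general_class I J f \<phi> \<longleftrightarrow> (\<forall>u\<in>I. \<forall>v\<in>J. kappa_m I f u * kappa J \<phi> v \<noteq> 0)"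

definition frame_X ::
  "real set \<Rightarrow> (real \<Rightarrow> real) \<Rightarrow> (real \<Rightarrow> real) \<Rightarrow> (real \<Rightarrow> real) \<Rightarrow> field" where
  "frame_X I f g \<phi> = Du I (meridian_surface f g \<phi>)"

definition frame_Y ::
  "real set \<Rightarrow> (real \<Rightarrow> real) \<Rightarrow> (real \<Rightarrow> real) \<Rightarrow> (real \<Rightarrow> real) \<Rightarrow> field" where
  "frame_Y J f g \<phi> u v =
     (1 / (f u * sqrt ((D J \<phi> v)\<^sup>2 + (\<phi> v)\<^sup>2))) *\<^sub>R Dv J (meridian_surface f g \<phi>) u v"

definition principal_x ::
  "real set \<Rightarrow> real set \<Rightarrow> (real \<Rightarrow> real) \<Rightarrow> (real \<Rightarrow> real) \<Rightarrow> (real \<Rightarrow> real) \<Rightarrow> field" where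
  "principal_x I J f g \<phi> u v = (1 / sqrt 2) *\<^sub>R (frame_X I f g \<phi> u v + frame_Y J f g \<phi> u v)"

definition principal_y ::
  "real set \<Rightarrow> real set \<Rightarrow> (real \<Rightarrow> real) \<Rightarrow> (real \<Rightarrow> real) \<Rightarrow> (real \<Rightarrow> real) \<Rightarrow> field" where
  "principal_y I J f g \<phi> u v = (1 / sqrt 2) *\<^sub>R (- frame_X I f g \<phi> u v + frame_Y J f g \<phi> u v)"

definition lambda_invariant ::
  "real set \<Rightarrow> real set \<Rightarrow> (real \<Rightarrow> real) \<Rightarrow> (real \<Rightarrow> real) \<Rightarrow> (real \<Rightarrow> real) \<Rightarrow> real \<Rightarrow> real \<Rightarrow> real"
  where
  "lambda_invariant I J f g \<phi> u v =
    (let z = meridian_surface f g \<phi> in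
     mink (nabla I J z (principal_x I J f g \<phi>) (principal_y I J f g \<phi>) u v)
          (unit_mean_curvature I J z u v))"

definition chen_surface ::
  "real set \<Rightarrow> real set \<Rightarrow> (real \<Rightarrow> real) \<Rightarrow> (real \<Rightarrow> real) \<Rightarrow> (real \<Rightarrow> real) \<Rightarrow> bool" where
  "chen_surface I J f g \<phi> \<longleftrightarrow> (\<forall>u\<in>I. \<forall>v\<in>J. lambda_invariant I J f g \<phi> u v = 0)"

text \<open>The sign \<open>s \<in> {1, -1}\<close> is the one chosen in both exponents.\<close>

definition chen_profile :: "int \<Rightarrow> real \<Rightarrow> real \<Rightarrow> real \<Rightarrow> real" where
  "chen_profile s b c t = 1 / (2 * c * t powi s) * (c\<^sup>2 * t powi (2 * s) + b\<^sup>2)"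

end

theory Submission
  imports Defs
begin

text \<open>Write \<open>z = f r + g \<xi>\<^sub>1\<close>, where \<open>r\<close> is a curve on the light cone with
  \<open>\<langle>r, \<xi>\<^sub>1\<rangle> = -1\<close> and \<open>\<langle>r', r'\<rangle> = \<phi>'\<^sup>2 + \<phi>\<^sup>2\<close>. The parameter lines are orthogonal, so
  \<open>H = (\<sigma>(X,X) + \<sigma>(Y,Y)) / 2\<close>, while the normal part of \<open>\<nabla>'\<^sub>x y\<close> is
  \<open>(\<sigma>(Y,Y) - \<sigma>(X,X)) / 2\<close>. Hence \<open>\<lambda> = 0\<close> iff \<open>\<sigma>(X,X)\<close> and \<open>\<sigma>(Y,Y)\<close> have the same square,
  which reads \<open>\<kappa>\<^sup>2 = f'\<^sup>2 - Q\<^sup>2\<close> with \<open>Q = f f'' / f'\<close>. The left side depends on \<open>v\<close> only and the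
  right side on \<open>u\<close> only, so \<open>\<kappa>\<close> is a constant \<open>b\<close>. Differentiating
  \<open>f'\<^sup>2 - Q\<^sup>2 = b\<^sup>2\<close> and dividing by \<open>Q \<noteq> 0\<close> gives \<open>Q' = f'\<^sup>2 / f\<close>; with \<open>f'' = Q f' / f\<close> this makes
  \<open>(f' + Q) / f\<close> a constant \<open>c\<close>, whence \<open>f' - Q = b\<^sup>2 / (c f)\<close> and
  \<open>2 f' = c f + b\<^sup>2 / (c f)\<close>. Replacing \<open>c\<close> by \<open>b\<^sup>2 / c\<close> exchanges the two signs
  of the exponent, so the sign \<open>+\<close> alone covers all solutions.\<close>

section \<open>Minkowski products\<close>

lemma mink_commute: "mink x y = mink y x"
  by (simp add: mink_def mult.commute)

lemma mink_bilinear [simp]: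
  "mink (x + y) w = mink x w + mink y w" "mink w (x + y) = mink w x + mink w y"
  "mink (x - y) w = mink x w - mink y w" "mink w (x - y) = mink w x - mink w y"
  "mink (- x) w = - mink x w" "mink w (- x) = - mink w x"
  "mink (a *\<^sub>R x) w = a * mink x w" "mink w (a *\<^sub>R x) = a * mink w x"
  "mink 0 w = 0" "mink w 0 = 0"
  by (simp_all add: mink_def algebra_simps)

definition null_frame :: "real \<Rightarrow> real \<Rightarrow> real \<Rightarrow> real \<Rightarrow> real^4" where
  "null_frame a b c d = a *\<^sub>R e1 + b *\<^sub>R e2 + c *\<^sub>R xi1 + d *\<^sub>R xi2"

lemma mink_null_frame:
  "mink (null_frame a b c d) (null_frame a' b' c' d') = a * a' + b * b' - c * d' - d * c'"
proof -
  have axes: "mink e1 e1 = 1" "mink e2 e2 = 1" "mink e3 e3 = 1" "mink e4 e4 = -1"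
    "mink e1 e2 = 0" "mink e1 e3 = 0" "mink e1 e4 = 0" "mink e2 e3 = 0" "mink e2 e4 = 0"
    "mink e3 e4 = 0"
    "mink e2 e1 = 0" "mink e3 e1 = 0" "mink e4 e1 = 0" "mink e3 e2 = 0" "mink e4 e2 = 0"
    "mink e4 e3 = 0"
    by (simp_all add: mink_def axis_def)
  show ?thesis
    by (simp add: null_frame_def xi1_def xi2_def axes field_simps)
qed

text \<open>The first two coordinates are the pair \<open>(a, b)\<close> rotated through the angle
  \<open>t\<close>; a rotation preserves the Euclidean part of the product, so \<open>t\<close>
  drops out. The curve \<open>r\<close> and its derivatives have this shape with
  \<open>t = v\<close>.\<close>

lemma mink_polar_frame:
  "mink (null_frame (a * cos t - b * sin t) (a * sin t + b * cos t) c d)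
     (null_frame (a' * cos t - b' * sin t) (a' * sin t + b' * cos t) c' d')
   = a * a' + b * b' - c * d' - d * c'"
proof -
  have "mink (null_frame (a * cos t - b * sin t) (a * sin t + b * cos t) c d)
     (null_frame (a' * cos t - b' * sin t) (a' * sin t + b' * cos t) c' d')
   = (a * a' + b * b') * ((sin t)\<^sup>2 + (cos t)\<^sup>2) - c * d' - d * c'"
    unfolding mink_null_frame power2_eq_square by (simp only: algebra_simps)
  then show ?thesis by simp
qed

lemma xi1_null_frame: "xi1 = null_frame 0 0 1 0"
  by (simp add: null_frame_def)

lemma has_vector_derivative_null_frame:
  assumes "(a has_real_derivative a') (at t within S)"
    and "(b has_real_derivative b') (at t within S)"
    and "(c has_real_derivative c') (at t within S)"
    and "(d has_real_derivative d') (at t within S)"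
  shows "((\<lambda>s. null_frame (a s) (b s) (c s) (d s)) has_vector_derivative null_frame a' b' c' d')
    (at t within S)"
proof -
  have scale: "((\<lambda>s. h s *\<^sub>R w) has_vector_derivative d *\<^sub>R w) (at t within S)"
    if "(h has_real_derivative d) (at t within S)" for h d and w :: "real^4"
    using has_vector_derivative_scaleR[OF that has_vector_derivative_const] by simp
  show ?thesis
    unfolding null_frame_def by (intro has_vector_derivative_add scale assms)
qed

section \<open>Calculus on intervals\<close>

text \<open>A connected set with more than one point has no isolated point. This makes derivatives
  within \<open>S\<close> unique, also at endpoints.\<close>

lemma nondegenerate_interval_nontrivial:
  assumes "nondegenerate_interval S" "t \<in> S"
  shows "at t within S \<noteq> bot"
proof -
  have conv: "convex S" and int: "interior S \<noteq> {}"
    using assms by (auto simp: nondegenerate_interval_def is_interval_convex)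
  have "t islimpt S"
  proof (rule connected_imp_perfect)
    show "connected S" using conv by (rule convex_connected)
    show "S \<noteq> {x}" for x using int by auto
  qed (rule assms)
  then show ?thesis
    by (simp add: trivial_limit_within)
qed

text \<open>Derivatives within \<open>S\<close> see only the values on \<open>S\<close>, so a
  formula known merely on the interval may be differentiated in place of \<open>h\<close>.\<close>

lemma D_eqI:
  assumes "nondegenerate_interval S" "t \<in> S"
    and "\<And>s. s \<in> S \<Longrightarrow> h s = k s"
    and "(k has_vector_derivative k') (at t within S)"
  shows "D S h t = k'"
proof -
  have "(h has_vector_derivative k') (at t within S)"
    using has_vector_derivative_transform[OF assms(2) assms(3) assms(4)] by simp
  then show ?thesis
    unfolding D_def
    by (rule vector_derivative_within[OF nondegenerate_interval_nontrivial[OF assms(1,2)]])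
qed

lemma smooth_on_D: "smooth_on S h \<Longrightarrow> smooth_on S (D S h)"
  unfolding smooth_on_def by (metis comp_apply funpow_Suc_right)

lemma smooth_on_has_vector_derivative:
  assumes "smooth_on S h" "t \<in> S"
  shows "(h has_vector_derivative D S h t) (at t within S)"
proof -
  have "h differentiable_on S"
    using assms(1) unfolding smooth_on_def by (metis funpow_0)
  then show ?thesis
    using assms(2) by (simp add: D_def differentiable_on_def vector_derivative_works)
qed

lemma smooth_on_has_real_derivative:
  fixes h :: "real \<Rightarrow> real"
  assumes "smooth_on S h" "t \<in> S"
  shows "(h has_real_derivative D S h t) (at t within S)"
  using smooth_on_has_vector_derivative[OF assms]
  by (simp add: has_real_derivative_iff_has_vector_derivative)

lemma smooth_on_continuous_on: "smooth_on S h \<Longrightarrow> continuous_on S h"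
  unfolding smooth_on_def by (metis funpow_0 differentiable_imp_continuous_on)

section \<open>Orthogonal parameterizations\<close>

text \<open>Pairing with one of two orthogonal non-null vectors isolates its coefficient; this gives
  the uniqueness that the description in \<open>coords\<close> relies on.\<close>

lemma coords_orthogonal:
  assumes "mink (Du I z u v) (Du I z u v) \<noteq> 0" "mink (Dv J z u v) (Dv J z u v) \<noteq> 0"
    and "mink (Du I z u v) (Dv J z u v) = 0"
    and T: "T u v = a *\<^sub>R Du I z u v + b *\<^sub>R Dv J z u v"
  shows "coords I J z T u v = (a, b)"
  unfolding coords_def
proof (rule the_equality)
  fix p assume p: "T u v = fst p *\<^sub>R Du I z u v + snd p *\<^sub>R Dv J z u v"
  have "mink (T u v) (Du I z u v) = a * mink (Du I z u v) (Du I z u v)"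
    "mink (T u v) (Dv J z u v) = b * mink (Dv J z u v) (Dv J z u v)"
    using assms(3) by (simp_all add: T mink_commute)
  moreover have "mink (T u v) (Du I z u v) = fst p * mink (Du I z u v) (Du I z u v)"
    "mink (T u v) (Dv J z u v) = snd p * mink (Dv J z u v) (Dv J z u v)"
    using assms(3) by (simp_all add: p mink_commute)
  ultimately show "p = (a, b)"
    using assms(1,2) by (simp add: prod_eq_iff)
qed (simp add: T)

text \<open>Gram-Schmidt projection. Since \<open>mink\<close> is indefinite, the squares in the
  denominators have to be assumed non-zero.\<close>

lemma normal_part_orthogonal:
  assumes "mink (Du I z u v) (Du I z u v) \<noteq> 0" "mink (Dv J z u v) (Dv J z u v) \<noteq> 0"
    and "mink (Du I z u v) (Dv J z u v) = 0"
  shows "normal_part I J z u v w =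
    w - (mink w (Du I z u v) / mink (Du I z u v) (Du I z u v)) *\<^sub>R Du I z u v
      - (mink w (Dv J z u v) / mink (Dv J z u v) (Dv J z u v)) *\<^sub>R Dv J z u v"
    (is "_ = ?n")
  unfolding normal_part_def
proof (rule the_equality)
  have orth: "mink (Dv J z u v) (Du I z u v) = 0"
    using assms(3) by (simp add: mink_commute)
  have "w - ?n \<in> span {Du I z u v, Dv J z u v}"
    by (auto intro!: span_add span_scale intro: span_base)
  then show "mink ?n (Du I z u v) = 0 \<and> mink ?n (Dv J z u v) = 0 \<and>
      w - ?n \<in> span {Du I z u v, Dv J z u v}"
    using assms orth by simp
  fix n assume n: "mink n (Du I z u v) = 0 \<and> mink n (Dv J z u v) = 0 \<and>
      w - n \<in> span {Du I z u v, Dv J z u v}"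
  then obtain a where "w - n - a *\<^sub>R Du I z u v \<in> span {Dv J z u v}"
    by (auto simp: span_breakdown_eq)
  then obtain b where "w - n - a *\<^sub>R Du I z u v = b *\<^sub>R Dv J z u v"
    by (auto simp: span_singleton)
  then have w: "w = n + a *\<^sub>R Du I z u v + b *\<^sub>R Dv J z u v"
    by (simp add: algebra_simps)
  have "mink w (Du I z u v) = a * mink (Du I z u v) (Du I z u v)"
    "mink w (Dv J z u v) = b * mink (Dv J z u v) (Dv J z u v)"
    using n orth assms(3) by (simp_all add: w)
  then have ab: "a = mink w (Du I z u v) / mink (Du I z u v) (Du I z u v)"
    "b = mink w (Dv J z u v) / mink (Dv J z u v) (Dv J z u v)"
    using assms(1,2) by simp_all
  then show "n = ?n"
    unfolding ab[symmetric] by (simp add: w)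
qed

section \<open>The geometry of a meridian surface\<close>

locale parabolic_meridian =
  fixes I J :: "real set" and f g \<phi> :: "real \<Rightarrow> real"
  assumes generators: "parabolic_generators I J f g \<phi>"
    and arc_length: "arc_length_meridians I f g"
begin

abbreviation "f' \<equiv> D I f"
abbreviation "f'' \<equiv> D I f'"
abbreviation "g' \<equiv> D I g"
abbreviation "g'' \<equiv> D I g'"
abbreviation "\<phi>' \<equiv> D J \<phi>"
abbreviation "\<phi>'' \<equiv> D J \<phi>'"
abbreviation "z \<equiv> meridian_surface f g \<phi>"

section \<open>The curve \<open>r\<close> on the light cone\<close>

definition r :: "real \<Rightarrow> real^4" where
  "r v = null_frame (\<phi> v * cos v) (\<phi> v * sin v) ((\<phi> v)\<^sup>2 / 2) 1"

text \<open>\<open>r'\<close> and \<open>r''\<close> are closed forms of the derivatives of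
  \<open>r\<close>, arranged to fit \<open>mink_polar_frame\<close>.\<close>

definition r' :: "real \<Rightarrow> real^4" where
  "r' v = null_frame (\<phi>' v * cos v - \<phi> v * sin v) (\<phi>' v * sin v + \<phi> v * cos v) (\<phi> v * \<phi>' v) 0"

definition r'' :: "real \<Rightarrow> real^4" where
  "r'' v = null_frame ((\<phi>'' v - \<phi> v) * cos v - 2 * \<phi>' v * sin v)
     ((\<phi>'' v - \<phi> v) * sin v + 2 * \<phi>' v * cos v) (\<phi> v * \<phi>'' v + (\<phi>' v)\<^sup>2) 0"

definition speed :: "real \<Rightarrow> real" where
  "speed v = sqrt ((\<phi>' v)\<^sup>2 + (\<phi> v)\<^sup>2)"

lemma I_interval: "nondegenerate_interval I" and J_interval: "nondegenerate_interval J"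
  and smooth_f: "smooth_on I f" and smooth_g: "smooth_on I g" and smooth_\<phi>: "smooth_on J \<phi>"
  and f_pos: "u \<in> I \<Longrightarrow> f u > 0"
  and speed_pos: "v \<in> J \<Longrightarrow> speed v > 0"
  using generators by (auto simp: parabolic_generators_def speed_def)

lemma speed_sq: "(speed v)\<^sup>2 = (\<phi>' v)\<^sup>2 + (\<phi> v)\<^sup>2"
  by (simp add: speed_def)

lemma f'_g': "u \<in> I \<Longrightarrow> f' u * g' u = - 1 / 2"
  using arc_length by (auto simp: arc_length_meridians_def field_simps)

lemma f'_nonzero: "u \<in> I \<Longrightarrow> f' u \<noteq> 0"
  using f'_g' by force

lemma g'_eq: "u \<in> I \<Longrightarrow> g' u = - 1 / (2 * f' u)"
  using f'_g'[of u] f'_nonzero[of u] by (simp add: field_simps)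

lemmas f_deriv = smooth_on_has_real_derivative[OF smooth_f]
lemmas f'_deriv = smooth_on_has_real_derivative[OF smooth_on_D[OF smooth_f]]
lemmas f''_deriv = smooth_on_has_real_derivative[OF smooth_on_D[OF smooth_on_D[OF smooth_f]]]
lemmas g_deriv = smooth_on_has_real_derivative[OF smooth_g]
lemmas g'_deriv = smooth_on_has_real_derivative[OF smooth_on_D[OF smooth_g]]
lemmas \<phi>_deriv = smooth_on_has_real_derivative[OF smooth_\<phi>]
lemmas \<phi>'_deriv = smooth_on_has_real_derivative[OF smooth_on_D[OF smooth_\<phi>]]

lemma g''_eq:
  assumes u: "u \<in> I"
  shows "g'' u = f'' u / (2 * (f' u)\<^sup>2)"
proof (rule D_eqI[OF I_interval u])
  show "((\<lambda>s. - 1 / (2 * f' s)) has_vector_derivative f'' u / (2 * (f' u)\<^sup>2)) (at u within I)"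
    unfolding has_real_derivative_iff_has_vector_derivative[symmetric]
    by (rule derivative_eq_intros f'_deriv[OF u] refl
        | use f'_nonzero[OF u] in \<open>simp add: power2_eq_square field_simps\<close>)+
qed (rule g'_eq)

lemma r_deriv: "v \<in> J \<Longrightarrow> (r has_vector_derivative r' v) (at v within J)"
  unfolding r_def[abs_def] r'_def
  by (rule has_vector_derivative_null_frame;
      (rule derivative_eq_intros \<phi>_deriv refl | assumption | simp add: power2_eq_square algebra_simps)+)

lemma r'_deriv: "v \<in> J \<Longrightarrow> (r' has_vector_derivative r'' v) (at v within J)"
  unfolding r'_def[abs_def] r''_def
  by (rule has_vector_derivative_null_frame;
      (rule derivative_eq_intros \<phi>_deriv \<phi>'_deriv refl | assumption
        | simp add: power2_eq_square algebra_simps)+)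

text \<open>Existence is enough: in the derivative of \<open>r' / speed\<close> the number
  \<open>d\<close> only multiplies \<open>r'\<close>, which is tangent and disappears when paired
  with \<open>H\<close>.\<close>

lemma speed_deriv:
  assumes v: "v \<in> J"
  shows "\<exists>d. ((\<lambda>t. 1 / speed t) has_real_derivative d) (at v within J)"
proof -
  have pos: "(\<phi>' v)\<^sup>2 + (\<phi> v)\<^sup>2 > 0"
    using speed_pos[OF v] by (simp add: speed_def)
  have "((\<lambda>t. (\<phi>' t)\<^sup>2 + (\<phi> t)\<^sup>2) has_real_derivative
      2 * \<phi>' v * \<phi>'' v + 2 * \<phi> v * \<phi>' v) (at v within J)"
    by (auto intro!: derivative_eq_intros \<phi>_deriv[OF v] \<phi>'_deriv[OF v])
  from DERIV_chain2[OF DERIV_inverse'[OF DERIV_real_sqrt[OF pos]] this]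
    real_sqrt_gt_zero[OF pos, THEN less_imp_neq, symmetric]
  show ?thesis
    unfolding speed_def[abs_def] inverse_eq_divide[symmetric] by blast
qed

lemma mink_r:
  "mink (r v) (r v) = 0" "mink (r v) (r' v) = 0" "mink (r' v) (r' v) = (speed v)\<^sup>2"
  "mink (r'' v) (r v) = - (speed v)\<^sup>2" "mink (r'' v) (r' v) = \<phi>' v * (\<phi>'' v + \<phi> v)"
  "mink (r'' v) (r'' v) = (\<phi>'' v - \<phi> v)\<^sup>2 + 4 * (\<phi>' v)\<^sup>2"
proof -
  \<comment> \<open>The zero terms bring \<open>r\<close> into the rotated shape as well.\<close>
  have r: "r v = null_frame (\<phi> v * cos v - 0 * sin v) (\<phi> v * sin v + 0 * cos v) ((\<phi> v)\<^sup>2 / 2) 1"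
    by (simp add: r_def)
  note polar = r r'_def r''_def mink_polar_frame speed_sq
  show "mink (r v) (r v) = 0" unfolding polar by (simp add: power2_eq_square)
  show "mink (r v) (r' v) = 0" unfolding polar by (simp add: power2_eq_square)
  show "mink (r' v) (r' v) = (speed v)\<^sup>2" unfolding polar by (simp add: power2_eq_square)
  show "mink (r'' v) (r v) = - (speed v)\<^sup>2" unfolding polar by (simp add: power2_eq_square algebra_simps)
  show "mink (r'' v) (r' v) = \<phi>' v * (\<phi>'' v + \<phi> v)" unfolding polar by (simp add: power2_eq_square algebra_simps)
  show "mink (r'' v) (r'' v) = (\<phi>'' v - \<phi> v)\<^sup>2 + 4 * (\<phi>' v)\<^sup>2" unfolding polar by (simp add: power2_eq_square)
qed

lemma mink_r_xi1:
  "mink xi1 xi1 = 0" "mink (r v) xi1 = - 1" "mink (r' v) xi1 = 0" "mink (r'' v) xi1 = 0"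
  by (simp_all add: r_def r'_def r''_def xi1_null_frame mink_null_frame)

text \<open>Both argument orders are listed, so that simplification evaluates every product among
  \<open>r\<close>, \<open>r'\<close>, \<open>r''\<close> and \<open>xi1\<close>.\<close>

lemmas mink_products = mink_r mink_r_xi1
  mink_r(2)[of v, unfolded mink_commute[of "r v" "r' v"]]
  mink_r(4)[of v, unfolded mink_commute[of "r'' v" "r v"]]
  mink_r(5)[of v, unfolded mink_commute[of "r'' v" "r' v"]]
  mink_r_xi1(2-)[unfolded mink_commute[of _ xi1]] for v

text \<open>Up to sign, \<open>kappa\<close> is the curvature of the plane curve
  \<open>\<phi> (cos v, sin v)\<close>. As \<open>r'\<close> and \<open>r''\<close> have no
  \<open>xi2\<close> component, their products are those of the planar parts, and by Lagrange's
  identity their Gram determinant is the square of the planar determinant.\<close>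

lemma kappa_sq:
  assumes v: "v \<in> J"
  shows "(kappa J \<phi> v)\<^sup>2 * (speed v)^6
    = (speed v)\<^sup>2 * mink (r'' v) (r'' v) - (mink (r'' v) (r' v))\<^sup>2"
proof -
  have pos: "(\<phi>' v)\<^sup>2 + (\<phi> v)\<^sup>2 > 0"
    using speed_pos[OF v] by (simp add: speed_def)
  have "((\<phi>' v)\<^sup>2 + (\<phi> v)\<^sup>2) powr (3 / 2) = (speed v) ^ 3"
    using powr_power[OF pos[THEN less_imp_neq, symmetric], of "1 / 2" 3] pos
    by (simp add: speed_def powr_half_sqrt)
  then have "kappa J \<phi> v * (speed v) ^ 3 = \<phi> v * \<phi>'' v - 2 * (\<phi>' v)\<^sup>2 - (\<phi> v)\<^sup>2"
    using speed_pos[OF v] by (simp add: kappa_def)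
  moreover have "(kappa J \<phi> v)\<^sup>2 * (speed v)^6 = (kappa J \<phi> v * (speed v) ^ 3)\<^sup>2"
    by (simp add: eval_nat_numeral ac_simps)
  ultimately have "(kappa J \<phi> v)\<^sup>2 * (speed v)^6
      = (\<phi> v * \<phi>'' v - 2 * (\<phi>' v)\<^sup>2 - (\<phi> v)\<^sup>2)\<^sup>2"
    by simp
  also have "\<dots> = (speed v)\<^sup>2 * mink (r'' v) (r'' v) - (mink (r'' v) (r' v))\<^sup>2"
    unfolding mink_r speed_sq by (simp add: power2_eq_square algebra_simps)
  finally show ?thesis .
qed

section \<open>Derivatives and first fundamental form of the surface\<close>

lemma surface_eq: "z u v = f u *\<^sub>R r v + g u *\<^sub>R xi1"
  by (simp add: meridian_surface_def r_def null_frame_def algebra_simps)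

lemma Du_z: "u \<in> I \<Longrightarrow> Du I z u v = f' u *\<^sub>R r v + g' u *\<^sub>R xi1"
  unfolding Du_def
  by (rule D_eqI[OF I_interval _ surface_eq])
    (auto intro!: derivative_eq_intros f_deriv g_deriv)

lemma Dv_z: "v \<in> J \<Longrightarrow> Dv J z u v = f u *\<^sub>R r' v"
  unfolding Dv_def
  by (rule D_eqI[OF J_interval _ surface_eq])
    (auto intro!: derivative_eq_intros r_deriv)

lemma Du_Du_z: "u \<in> I \<Longrightarrow> Du I (Du I z) u v = f'' u *\<^sub>R r v + g'' u *\<^sub>R xi1"
  unfolding Du_def[of I "Du I z"]
  by (rule D_eqI[OF I_interval _ Du_z])
    (auto intro!: derivative_eq_intros f'_deriv g'_deriv)

lemma Dv_Dv_z: "v \<in> J \<Longrightarrow> Dv J (Dv J z) u v = f u *\<^sub>R r'' v"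
  unfolding Dv_def[of J "Dv J z"]
  by (rule D_eqI[OF J_interval _ Dv_z])
    (auto intro!: derivative_eq_intros r'_deriv)

lemma first_fundamental_form:
  assumes "u \<in> I" "v \<in> J"
  shows "mink (Du I z u v) (Du I z u v) = 1" "mink (Du I z u v) (Dv J z u v) = 0"
    "mink (Dv J z u v) (Dv J z u v) = (f u * speed v)\<^sup>2"
  using f'_g'[OF assms(1)]
  by (simp_all add: Du_z Dv_z assms mink_products power2_eq_square algebra_simps)


section \<open>Second fundamental tensor and mean curvature\<close>

definition normal_XX :: "real \<Rightarrow> real \<Rightarrow> real^4" where
  "normal_XX u v = f'' u *\<^sub>R r v + g'' u *\<^sub>R xi1"

text \<open>This is \<open>\<sigma>(Y,Y)\<close>: the vector \<open>z_vv / (f speed)^2\<close> less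
  its projections on \<open>z_u\<close> and \<open>r'\<close>. The plus sign comes from
  \<open>\<langle>r'', z_u\<rangle> = - f' speed^2\<close>.\<close>

definition normal_YY :: "real \<Rightarrow> real \<Rightarrow> real^4" where
  "normal_YY u v = (1 / (f u * (speed v)\<^sup>2)) *\<^sub>R r'' v + (f' u / f u) *\<^sub>R Du I z u v
     - (mink (r'' v) (r' v) / (f u * (speed v)^4)) *\<^sub>R r' v"

text \<open>\<open>z_uu\<close> is normal without correction: differentiating the arc length
  condition gives \<open>f'' g' + f' g'' = 0\<close>, and both \<open>r\<close> and
  \<open>xi1\<close> are orthogonal to \<open>r'\<close>.\<close>

lemma normal_XX_orthogonal:
  assumes u: "u \<in> I"
  shows "mink (normal_XX u v) (Du I z u v) = 0" "mink (normal_XX u v) (r' v) = 0"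
proof -
  have "f'' u * g' u + g'' u * f' u = 0"
    using f'_nonzero[OF u] by (simp add: g'_eq g''_eq u power2_eq_square)
  then show "mink (normal_XX u v) (Du I z u v) = 0"
    by (simp add: normal_XX_def Du_z u mink_products algebra_simps)
qed (simp add: normal_XX_def mink_products)

lemma normal_YY_orthogonal:
  assumes u: "u \<in> I" and v: "v \<in> J"
  shows "mink (normal_YY u v) (Du I z u v) = 0" "mink (normal_YY u v) (r' v) = 0"
proof -
  have "mink (Du I z u v) (Du I z u v) = 1"
    using u v by (rule first_fundamental_form)
  then show "mink (normal_YY u v) (Du I z u v) = 0"
    using f_pos[OF u] speed_pos[OF v]
    \<comment> \<open>The square of \<open>z_u\<close> is used as 1 before the remaining
      \<open>z_u\<close> is expanded.\<close>
    by (simp add: normal_YY_def mink_products) (simp add: Du_z u mink_products)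
  have "mink (Du I z u v) (r' v) = 0"
    by (simp add: Du_z u mink_products)
  then show "mink (normal_YY u v) (r' v) = 0"
    using f_pos[OF u] speed_pos[OF v]
    by (simp add: normal_YY_def mink_products(3)) (simp add: power_def field_simps)
qed

lemma mink_normals:
  assumes u: "u \<in> I" and v: "v \<in> J"
  shows "mink (normal_XX u v) (normal_XX u v) = - (f'' u / f' u)\<^sup>2"
    and "mink (normal_YY u v) (normal_YY u v) = ((kappa J \<phi> v)\<^sup>2 - (f' u)\<^sup>2) / (f u)\<^sup>2"
proof -
  note nz = f_pos[OF u] speed_pos[OF v] f'_nonzero[OF u]
  show "mink (normal_XX u v) (normal_XX u v) = - (f'' u / f' u)\<^sup>2"
    using nz by (simp add: normal_XX_def mink_products g''_eq u power2_eq_square)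
  \<comment> \<open>Only one factor is unfolded: its terms in \<open>z_u\<close> and
    \<open>r'\<close> are orthogonal to the other, so just \<open>r''\<close> contributes.\<close>
  have "mink (normal_YY u v) (normal_YY u v)
    = mink (normal_YY u v) (r'' v) / (f u * (speed v)\<^sup>2)"
    using normal_YY_orthogonal[OF u v] by (subst (2) normal_YY_def) simp
  also have "mink (normal_YY u v) (r'' v) = mink (r'' v) (r'' v) / (f u * (speed v)\<^sup>2)
      - (f' u)\<^sup>2 * (speed v)\<^sup>2 / f u - (mink (r'' v) (r' v))\<^sup>2 / (f u * (speed v)^4)"
  proof -
    have "mink (Du I z u v) (r'' v) = - f' u * (speed v)\<^sup>2"
      by (simp add: Du_z u mink_products)
    then show ?thesis
      by (simp add: normal_YY_def mink_commute[of "r' v" "r'' v"] power2_eq_square[of "f' u"]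
          power2_eq_square[of "mink (r'' v) (r' v)"])
  qed
  also have "\<dots> / (f u * (speed v)\<^sup>2)
      = ((speed v)\<^sup>2 * mink (r'' v) (r'' v) - (mink (r'' v) (r' v))\<^sup>2) / ((f u)\<^sup>2 * (speed v)^6)
        - (f' u)\<^sup>2 / (f u)\<^sup>2"
    using nz by (simp add: field_simps eval_nat_numeral)
  also have "\<dots> = ((kappa J \<phi> v)\<^sup>2 - (f' u)\<^sup>2) / (f u)\<^sup>2"
    using nz by (simp add: kappa_sq[OF v, symmetric] diff_divide_distrib)
  finally show "mink (normal_YY u v) (normal_YY u v) = ((kappa J \<phi> v)\<^sup>2 - (f' u)\<^sup>2) / (f u)\<^sup>2" .
qed

lemma coords_z:
  assumes "u \<in> I" "v \<in> J" "T u v = a *\<^sub>R Du I z u v + b *\<^sub>R Dv J z u v"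
  shows "coords I J z T u v = (a, b)"
  using f_pos[OF assms(1)] speed_pos[OF assms(2)]
  by (intro coords_orthogonal assms(3)) (simp_all add: first_fundamental_form assms)

lemma second_fundamental_form:
  assumes u: "u \<in> I" and v: "v \<in> J"
  shows "second_fundamental I J z (Du I z) (Du I z) u v = normal_XX u v"
    and "second_fundamental I J z (Dv J z) (Dv J z) u v = (f u * speed v)\<^sup>2 *\<^sub>R normal_YY u v"
proof -
  note nz = f_pos[OF u] speed_pos[OF v]
  have normal: "normal_part I J z u v w = w - mink w (Du I z u v) *\<^sub>R Du I z u v
      - (mink w (Dv J z u v) / (f u * speed v)\<^sup>2) *\<^sub>R Dv J z u v" for w
    using nz by (subst normal_part_orthogonal) (simp_all add: first_fundamental_form u v)
  have "nabla I J z (Du I z) (Du I z) u v = normal_XX u v"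
    by (simp add: nabla_def coords_z[OF u v, of _ 1 0] Du_Du_z u normal_XX_def)
  then show "second_fundamental I J z (Du I z) (Du I z) u v = normal_XX u v"
    using normal_XX_orthogonal[OF u, of v] by (simp add: second_fundamental_def normal Dv_z v)
  have "nabla I J z (Dv J z) (Dv J z) u v = f u *\<^sub>R r'' v"
    by (simp add: nabla_def coords_z[OF u v, of _ 0 1] Dv_Dv_z v)
  moreover have "mink (r'' v) (Du I z u v) = - f' u * (speed v)\<^sup>2"
    by (simp add: Du_z u mink_products)
  ultimately show "second_fundamental I J z (Dv J z) (Dv J z) u v
      = (f u * speed v)\<^sup>2 *\<^sub>R normal_YY u v"
    using nz by (simp add: second_fundamental_def normal normal_YY_def Dv_z v scaleR_diff_right
      scaleR_add_right) (simp add: power2_eq_square power4_eq_xxxx field_simps)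
qed

text \<open>With \<open>E = 1\<close> and \<open>F = 0\<close> the trace is
  \<open>\<sigma>(z_u,z_u) + \<sigma>(z_v,z_v) / G\<close>, and \<open>G\<close> cancels the factor
  in front of \<open>normal_YY\<close>.\<close>

lemma mean_curvature_eq:
  assumes "u \<in> I" "v \<in> J"
  shows "mean_curvature I J z u v = (1 / 2) *\<^sub>R (normal_XX u v + normal_YY u v)"
  using f_pos[OF assms(1)] speed_pos[OF assms(2)]
  by (simp add: mean_curvature_def first_fundamental_form second_fundamental_form assms
      scaleR_add_right)

section \<open>The invariant \<open>\<lambda>\<close>\<close>

text \<open>The result is needed only modulo \<open>r'\<close>, because it will be paired with the
  normal vector \<open>H\<close>; all contributions of \<open>X_v\<close> and of the derivative of
  \<open>1 / speed\<close> go into \<open>k\<close>.\<close>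

lemma nabla_principal:
  assumes u: "u \<in> I" and v: "v \<in> J"
  shows "\<exists>k. nabla I J z (principal_x I J f g \<phi>) (principal_y I J f g \<phi>) u v
    = (1 / 2) *\<^sub>R (- normal_XX u v + (1 / (f u * (speed v)\<^sup>2)) *\<^sub>R r'' v) + k *\<^sub>R r' v"
proof -
  note nz = f_pos[OF u] speed_pos[OF v]
  \<comment> \<open>One factor \<open>1 / sqrt 2\<close> comes from the direction \<open>x\<close>,
    the other from the field \<open>y\<close>.\<close>
  have combine: "(1 / sqrt 2) *\<^sub>R ((1 / sqrt 2) *\<^sub>R p) + (1 / sqrt 2 * e) *\<^sub>R ((1 / sqrt 2) *\<^sub>R q)
      = (1 / 2) *\<^sub>R p + (1 / 2 * e) *\<^sub>R q" for p q :: "real^4" and e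
  proof -
    have "1 / sqrt 2 * (1 / sqrt 2) = (1 / 2 :: real)" "1 / sqrt 2 * e * (1 / sqrt 2) = 1 / 2 * e"
      by simp_all
    then show ?thesis by (simp only: scaleR_scaleR)
  qed
  have X: "frame_X I f g \<phi> s t = Du I z s t" for s t
    by (simp add: frame_X_def)
  \<comment> \<open>The factor \<open>f\<close> cancels, so \<open>Y\<close> does not depend on
    \<open>u\<close> and only \<open>-X\<close> contributes to the \<open>u\<close>-derivative of
    \<open>y\<close>.\<close>
  have Y: "frame_Y J f g \<phi> s t = (1 / speed t) *\<^sub>R r' t" if "s \<in> I" "t \<in> J" for s t
    using f_pos[OF that(1)] by (simp add: frame_Y_def Dv_z that speed_def)
  have x: "coords I J z (principal_x I J f g \<phi>) u v
      = (1 / sqrt 2, 1 / sqrt 2 * (1 / (f u * speed v)))"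
    by (rule coords_z[OF u v])
      (simp add: principal_x_def frame_X_def frame_Y_def speed_def scaleR_add_right)
  have y: "principal_y I J f g \<phi> s t
      = (1 / sqrt 2) *\<^sub>R (- (f' s *\<^sub>R r t + g' s *\<^sub>R xi1) + (1 / speed t) *\<^sub>R r' t)"
    if "s \<in> I" "t \<in> J" for s t
    using that by (simp add: principal_y_def X Y Du_z)
  have yu: "Du I (principal_y I J f g \<phi>) u v = (1 / sqrt 2) *\<^sub>R (- normal_XX u v)"
    unfolding Du_def
    by (rule D_eqI[OF I_interval u y[OF _ v]])
      (auto intro!: derivative_eq_intros f'_deriv[OF u] g'_deriv[OF u] simp: normal_XX_def)
  define k where "k t = 1 / speed t" for t
  obtain d where "(k has_real_derivative d) (at v within J)"
    using speed_deriv[OF v] by (auto simp: k_def[abs_def])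
  then have yv: "Dv J (principal_y I J f g \<phi>) u v
      = (1 / sqrt 2) *\<^sub>R (- (f' u *\<^sub>R r' v) + (k v *\<^sub>R r'' v + d *\<^sub>R r' v))"
    unfolding Dv_def
    by (intro D_eqI[OF J_interval v y[OF u, folded k_def]])
      (auto intro!: derivative_eq_intros r_deriv[OF v] r'_deriv[OF v])
  have "nabla I J z (principal_x I J f g \<phi>) (principal_y I J f g \<phi>) u v
    = (1 / 2) *\<^sub>R (- normal_XX u v) + (1 / 2 * (1 / (f u * speed v))) *\<^sub>R
      (- (f' u *\<^sub>R r' v) + ((1 / speed v) *\<^sub>R r'' v + d *\<^sub>R r' v))"
    unfolding nabla_def x yu yv k_def fst_conv snd_conv by (rule combine)
  also have "\<dots> = (1 / 2) *\<^sub>R (- normal_XX u v + (1 / (f u * (speed v)\<^sup>2)) *\<^sub>R r'' v)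
      + ((d - f' u) / (2 * (f u * speed v))) *\<^sub>R r' v"
    by (simp add: algebra_simps power2_eq_square diff_divide_distrib)
  finally show ?thesis by blast
qed

text \<open>Modulo tangent vectors, \<open>r'' / (f speed^2)\<close> is \<open>normal_YY\<close>.
  The pairing is therefore that of \<open>B - A\<close> with \<open>A + B\<close>, whose mixed terms
  cancel by symmetry; the factor 4 clears the two halves.\<close>

lemma mink_nabla_principal_mean_curvature:
  assumes u: "u \<in> I" and v: "v \<in> J"
  shows "4 * mink (nabla I J z (principal_x I J f g \<phi>) (principal_y I J f g \<phi>) u v)
      (mean_curvature I J z u v)
    = ((kappa J \<phi> v)\<^sup>2 - (f' u)\<^sup>2) / (f u)\<^sup>2 + (f'' u / f' u)\<^sup>2"
proof -
  let ?A = "normal_XX u v" and ?B = "normal_YY u v" and ?C = "(1 / (f u * (speed v)\<^sup>2)) *\<^sub>R r'' v"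
  obtain k where k: "nabla I J z (principal_x I J f g \<phi>) (principal_y I J f g \<phi>) u v
      = (1 / 2) *\<^sub>R (- ?A + ?C) + k *\<^sub>R r' v"
    using nabla_principal[OF u v] by blast
  have C: "?C = ?B - (f' u / f u) *\<^sub>R Du I z u v
      + (mink (r'' v) (r' v) / (f u * (speed v)^4)) *\<^sub>R r' v"
    by (simp add: normal_YY_def)
  have "4 * mink ((1 / 2) *\<^sub>R (- ?A + ?C) + k *\<^sub>R r' v) ((1 / 2) *\<^sub>R (?A + ?B))
      = mink ?B ?B - mink ?A ?A"
    unfolding C using normal_XX_orthogonal[OF u, of v] normal_YY_orthogonal[OF u v]
    by (simp add: mink_commute[of "r' v" ?A] mink_commute[of "r' v" ?B] mink_commute[of "Du I z u v" ?A]
        mink_commute[of "Du I z u v" ?B] mink_commute[of ?B ?A] diff_divide_distrib)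
  then show ?thesis
    by (simp only: k mean_curvature_eq[OF u v] mink_normals[OF u v])
qed

lemma chen_surface_iff:
  assumes "\<forall>u\<in>I. \<forall>v\<in>J. mink (mean_curvature I J z u v) (mean_curvature I J z u v) \<noteq> 0"
  shows "chen_surface I J f g \<phi>
    \<longleftrightarrow> (\<forall>u\<in>I. \<forall>v\<in>J. (kappa J \<phi> v)\<^sup>2 = (f' u)\<^sup>2 - (f u * f'' u / f' u)\<^sup>2)"
proof -
  have "lambda_invariant I J f g \<phi> u v = 0
      \<longleftrightarrow> (kappa J \<phi> v)\<^sup>2 = (f' u)\<^sup>2 - (f u * f'' u / f' u)\<^sup>2"
    if u: "u \<in> I" and v: "v \<in> J" for u v
  proof -
    let ?m = "mink (nabla I J z (principal_x I J f g \<phi>) (principal_y I J f g \<phi>) u v)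
      (mean_curvature I J z u v)"
    \<comment> \<open>The assumption on \<open>H\<close> makes the normalizing factor non-zero, so
      the unit normal may be replaced by \<open>H\<close>.\<close>
    have "lambda_invariant I J f g \<phi> u v = 0 \<longleftrightarrow> 4 * ?m = 0"
      using assms u v by (simp add: lambda_invariant_def unit_mean_curvature_def Let_def)
    also have "\<dots> \<longleftrightarrow> (f u)\<^sup>2 * (((kappa J \<phi> v)\<^sup>2 - (f' u)\<^sup>2) / (f u)\<^sup>2 + (f'' u / f' u)\<^sup>2) = 0"
      using f_pos[OF u] by (simp only: mink_nabla_principal_mean_curvature[OF u v]) simp
    also have "(f u)\<^sup>2 * (((kappa J \<phi> v)\<^sup>2 - (f' u)\<^sup>2) / (f u)\<^sup>2 + (f'' u / f' u)\<^sup>2)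
        = (kappa J \<phi> v)\<^sup>2 - (f' u)\<^sup>2 + (f u * f'' u / f' u)\<^sup>2"
      using f_pos[OF u] by (simp add: distrib_left power_divide power_mult_distrib)
    finally show ?thesis by (simp add: algebra_simps)
  qed
  then show ?thesis
    by (simp add: chen_surface_def)
qed

section \<open>Chen surfaces\<close>

lemma continuous_on_kappa: "continuous_on J (kappa J \<phi>)"
proof -
  have "(\<phi>' v)\<^sup>2 + (\<phi> v)\<^sup>2 \<noteq> 0" if "v \<in> J" for v
    using generators that by (auto simp: parabolic_generators_def)
  then show ?thesis
    unfolding kappa_def[abs_def]
    by (intro continuous_intros smooth_on_continuous_on smooth_on_D smooth_\<phi>) auto
qed

text \<open>The square leaves at most two values, and a continuous function with finite range on a
  connected set is constant.\<close>

lemma kappa_constant: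
  assumes "\<And>v. v \<in> J \<Longrightarrow> (kappa J \<phi> v)\<^sup>2 = a"
  obtains b where "\<And>v. v \<in> J \<Longrightarrow> kappa J \<phi> v = b"
proof -
  have "kappa J \<phi> ` J \<subseteq> {sqrt a, - sqrt a}"
    using assms by (auto simp: real_sqrt_abs) (metis abs_if minus_minus real_sqrt_abs)
  moreover have "connected J"
    using J_interval by (auto simp: nondegenerate_interval_def is_interval_connected)
  ultimately have "kappa J \<phi> constant_on J"
    by (intro continuous_finite_range_constant continuous_on_kappa) (auto intro: finite_subset)
  then show thesis
    using that by (auto simp: constant_on_def)
qed

lemma meridian_profile:
  assumes eq: "\<And>u. u \<in> I \<Longrightarrow> b\<^sup>2 = (f' u)\<^sup>2 - (f u * f'' u / f' u)\<^sup>2"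
    and "b \<noteq> 0" and f'': "\<And>u. u \<in> I \<Longrightarrow> f'' u \<noteq> 0"
  obtains c where "c \<noteq> 0" "\<And>u. u \<in> I \<Longrightarrow> f' u = chen_profile 1 b c (f u)"
proof -
  define Q where "Q u = f u * f'' u / f' u" for u
  have Q_nonzero: "Q u \<noteq> 0" if "u \<in> I" for u
    using f_pos[OF that] f'_nonzero[OF that] f''[OF that] by (simp add: Q_def)
  have f''_Q: "f'' u = Q u * f' u / f u" if "u \<in> I" for u
    using f_pos[OF that] f'_nonzero[OF that] by (simp add: Q_def)
  have eq': "b\<^sup>2 = (f' u)\<^sup>2 - (Q u)\<^sup>2" if "u \<in> I" for u
    using eq[OF that] by (simp add: Q_def)
  have Q_deriv: "(Q has_real_derivative (f' u)\<^sup>2 / f u) (at u within I)" if u: "u \<in> I" for u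
  proof -
    \<comment> \<open>The quotient rule serves only for existence; the value of \<open>q\<close>,
      free of third derivatives, follows by differentiating the first integral.\<close>
    obtain q where q: "(Q has_real_derivative q) (at u within I)"
      unfolding Q_def[abs_def]
      using DERIV_divide[OF DERIV_mult[OF f_deriv[OF u] f''_deriv[OF u]] f'_deriv[OF u] f'_nonzero[OF u]]
      by blast
    have "((\<lambda>u. (f' u)\<^sup>2 - (Q u)\<^sup>2) has_real_derivative 2 * f' u * f'' u - 2 * Q u * q) (at u within I)"
      by (auto intro!: derivative_eq_intros q f'_deriv[OF u])
    then have "D I (\<lambda>u. (f' u)\<^sup>2 - (Q u)\<^sup>2) u = 2 * f' u * f'' u - 2 * Q u * q"
      by (intro D_eqI[OF I_interval u]) (auto simp: has_real_derivative_iff_has_vector_derivative)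
    \<comment> \<open>On \<open>I\<close> the same function is the constant
      \<open>b^2\<close>.\<close>
    moreover have "D I (\<lambda>u. (f' u)\<^sup>2 - (Q u)\<^sup>2) u = 0"
      by (rule D_eqI[OF I_interval u eq'[symmetric]]) (auto intro!: derivative_eq_intros)
    ultimately have "Q u * q = f' u * f'' u"
      by simp
    \<comment> \<open>Substituting \<open>f'' = Q f' / f\<close> exposes a factor \<open>Q\<close>,
      which can be cancelled.\<close>
    also have "\<dots> = Q u * ((f' u)\<^sup>2 / f u)"
      unfolding f''_Q[OF u] by (simp add: power2_eq_square)
    finally have "q = (f' u)\<^sup>2 / f u"
      by (rule mult_left_cancel[OF Q_nonzero[OF u], THEN iffD1])
    then show ?thesis
      using q by simp
  qed
  \<comment> \<open>Here \<open>(f' + Q)' = Q f' / f + f'^2 / f = (f' / f) (f' + Q)\<close>, so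
    numerator and denominator have the same logarithmic growth.\<close>
  have "((\<lambda>u. (f' u + Q u) / f u) has_real_derivative 0) (at u within I)" if u: "u \<in> I" for u
    using f_pos[OF u] f''_Q[OF u]
    by (auto intro!: derivative_eq_intros f_deriv[OF u] f'_deriv[OF u] Q_deriv[OF u]
        simp: field_simps power2_eq_square)
  moreover have "convex I"
    using I_interval by (simp add: nondegenerate_interval_def is_interval_convex)
  ultimately obtain c where quotient: "\<And>u. u \<in> I \<Longrightarrow> (f' u + Q u) / f u = c"
    using has_vector_derivative_zero_constant[of I "\<lambda>u. (f' u + Q u) / f u"]
    by (auto simp: has_real_derivative_iff_has_vector_derivative)
  have c: "f' u + Q u = c * f u" if "u \<in> I" for u
    using f_pos[OF that] quotient[OF that] by (auto simp: field_simps)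
  \<comment> \<open>Factor the first integral as \<open>(f' + Q) (f' - Q)\<close>.\<close>
  have b: "c * f u * (f' u - Q u) = b\<^sup>2" if "u \<in> I" for u
    using eq'[OF that] by (simp flip: c[OF that] add: power2_eq_square algebra_simps)
  obtain u0 where "u0 \<in> I"
    using I_interval interior_subset by (fastforce simp: nondegenerate_interval_def)
  then have "c \<noteq> 0"
    using b \<open>b \<noteq> 0\<close> by force
  moreover have "f' u = chen_profile 1 b c (f u)" if u: "u \<in> I" for u
  proof -
    have "f' u - Q u = b\<^sup>2 / (c * f u)"
      using b[OF u] \<open>c \<noteq> 0\<close> f_pos[OF u] by (simp add: field_simps)
    \<comment> \<open>Sum of the formulas for \<open>f' + Q\<close> and
      \<open>f' - Q\<close>.\<close>
    then have "2 * f' u = c * f u + b\<^sup>2 / (c * f u)"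
      using c[OF u] by linarith
    then show ?thesis
      using \<open>c \<noteq> 0\<close> f_pos[OF u] by (simp add: chen_profile_def field_simps power2_eq_square)
  qed
  ultimately show thesis by (rule that)
qed

text \<open>For either sign the profile is \<open>(a t + e / t) / 2\<close> with
  \<open>a e = b^2\<close>. The chain rule gives \<open>f f'' / f' = (a f - e / f) / 2\<close>, and
  the difference of the two squares is \<open>a e\<close>.\<close>

lemma profile_first_integral:
  assumes "c \<noteq> 0" "s \<in> {1, -1}" and eq: "\<And>u. u \<in> I \<Longrightarrow> f' u = chen_profile s b c (f u)"
    and u: "u \<in> I"
  shows "b\<^sup>2 = (f' u)\<^sup>2 - (f u * f'' u / f' u)\<^sup>2"
proof -
  note nz = f_pos[OF u] f'_nonzero[OF u] \<open>c \<noteq> 0\<close>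
  obtain a e where ae: "a * e = b\<^sup>2"
    and profile: "\<And>t. t > 0 \<Longrightarrow> chen_profile s b c t = (a * t + e / t) / 2"
  proof (cases "s = 1")
    case True
    show thesis
      by (rule that[of c "b\<^sup>2 / c"])
        (use \<open>c \<noteq> 0\<close> True in \<open>simp_all add: chen_profile_def field_simps power2_eq_square\<close>)
  next
    case False
    then have "s = -1" using assms(2) by simp
    show thesis
      by (rule that[of "b\<^sup>2 / c" c])
        (use \<open>c \<noteq> 0\<close> in \<open>simp_all add: chen_profile_def \<open>s = -1\<close> power_int_minus field_simps power2_eq_square\<close>)
  qed
  have f': "f' u = (a * f u + e / f u) / 2" if "u \<in> I" for u
    using eq[OF that] profile[OF f_pos[OF that]] by simp
  have "f'' u = (a - e / (f u)\<^sup>2) * f' u / 2"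
  proof (rule D_eqI[OF I_interval u f'])
    show "((\<lambda>u. (a * f u + e / f u) / 2) has_vector_derivative (a - e / (f u)\<^sup>2) * f' u / 2)
        (at u within I)"
      unfolding has_real_derivative_iff_has_vector_derivative[symmetric]
      using nz by (auto intro!: derivative_eq_intros f_deriv[OF u]
          simp: field_simps power2_eq_square)
  qed
  then have quotient: "f u * f'' u / f' u = (a * f u - e / f u) / 2"
    using nz by (simp add: field_simps power2_eq_square)
  show ?thesis
    unfolding quotient unfolding f'[OF u] ae[symmetric]
    using f_pos[OF u] by (simp add: power2_eq_square field_simps)
qed

end

theorem theorem6p1:
  fixes I J :: "real set" and f g \<phi> :: "real \<Rightarrow> real"
  assumes "parabolic_generators I J f g \<phi>"
    and "arc_length_meridians I f g"
    and "general_class I J f \<phi>"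
    and "\<forall>u\<in>I. \<forall>v\<in>J.
      mink (mean_curvature I J (meridian_surface f g \<phi>) u v)
           (mean_curvature I J (meridian_surface f g \<phi>) u v) \<noteq> 0"
  shows "chen_surface I J f g \<phi> \<longleftrightarrow>
    (\<exists>b. b \<noteq> 0 \<and> (\<forall>v\<in>J. kappa J \<phi> v = b) \<and>
      (\<exists>c s. c \<noteq> 0 \<and> s \<in> {1, -1} \<and> (\<forall>u\<in>I. D I f u = chen_profile s b c (f u))) \<and>
      (\<forall>u\<in>I. D I g u = - 1 / (2 * D I f u)))"
    (is "_ \<longleftrightarrow> (\<exists>b. ?R b)")
proof -
  interpret parabolic_meridian I J f g \<phi>
    by unfold_locales (rule assms)+
  note iff = chen_surface_iff[OF assms(4)]
  have "interior I \<noteq> {}" "interior J \<noteq> {}"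
    using I_interval J_interval by (simp_all add: nondegenerate_interval_def)
  then obtain u0 v0 where u0: "u0 \<in> I" and v0: "v0 \<in> J"
    using interior_subset by fastforce
  \<comment> \<open>\<open>general_class\<close> speaks of products, so a point \<open>v0\<close> of
    \<open>J\<close> is used to extract the factor \<open>kappa_m\<close>.\<close>
  have f'': "f'' u \<noteq> 0" if "u \<in> I" for u
    using assms(3) that v0 by (auto simp: general_class_def kappa_m_def)
  show ?thesis
  proof
    assume "chen_surface I J f g \<phi>"
    then have chen: "(kappa J \<phi> v)\<^sup>2 = (f' u)\<^sup>2 - (f u * f'' u / f' u)\<^sup>2"
      if "u \<in> I" "v \<in> J" for u v
      using iff that by simp
    \<comment> \<open>With \<open>u0\<close> fixed, the right side of \<open>chen\<close> is one
      number for all \<open>v\<close>.\<close>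
    obtain b where b: "\<And>v. v \<in> J \<Longrightarrow> kappa J \<phi> v = b"
      using kappa_constant[OF chen[OF u0]] by blast
    have "b \<noteq> 0"
      using assms(3) u0 v0 b by (auto simp: general_class_def)
    have "b\<^sup>2 = (f' u)\<^sup>2 - (f u * f'' u / f' u)\<^sup>2" if "u \<in> I" for u
      using chen[OF that v0] b[OF v0] by simp
    then obtain c where "c \<noteq> 0" "\<And>u. u \<in> I \<Longrightarrow> f' u = chen_profile 1 b c (f u)"
      using meridian_profile \<open>b \<noteq> 0\<close> f'' by blast
    \<comment> \<open>The sign is \<open>s = 1\<close>; the formula for \<open>g'\<close> is the arc
      length condition solved for \<open>g'\<close>.\<close>
    then have "?R b"
      using \<open>b \<noteq> 0\<close> b g'_eq by blast
    then show "\<exists>b. ?R b" ..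
  next
    assume "\<exists>b. ?R b"
    then obtain b c s where "\<forall>v\<in>J. kappa J \<phi> v = b" "c \<noteq> 0" "s \<in> {1, -1}"
      "\<forall>u\<in>I. f' u = chen_profile s b c (f u)"
      by blast
    then show "chen_surface I J f g \<phi>"
      using iff profile_first_integral by simp
  qed
qed

end
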